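(* Let $b$ be a rational number with $b\neq 1$ and let $c=2$. Then the cubic polynomials $P(x)$ and $Q(d)$ (defined in the context) are reducible over $\mathbb{Q}$. Moreover, if $b=\frac{2t}{(t+2)^2-2}$ for some rational $t$, then each of $P$ and $Q$ has three rational roots (counted with multiplicity), these roots can be labelled $x_1,x_2,x_3$ (roots of $P$) and $d_1,d_2,d_3$ (roots of $Q$) so that the auxiliary equations hold, but these six numbers are not all positive, so they do not provide a solution of the perfect cuboid problem (Problem 1.2).
   Context: Let $b,c$ be rational numbers. Put $\Delta=b^2c^4-6b^2c^3+13b^2c^2-12b^2c+4b^2+c^2$ and $N=(bc-1-b)(bc-c-2b)$, and assume $\Delta\,N\neq 0$, so that all the following rational numbers are defined (with $D=b^2c^2+2b^2-3b^2c+c-bc^2+2b$): $E_{11}=-\frac{b(c^2+2-4c)}{D}$, $E_{01}=-\frac{b(c^2+2-2c)}{D}$, $E_{10}=-\frac{b^2c^2+2b^2-3b^2c-c}{D}$; $E_{20}=\frac{b}{2}(bc^2-2c-2b)(2bc^2-c^2-6bc+2+4b)(bc-1-b)^{-2}(bc-c-2b)^{-2}$; $E_{02}=\frac12(28b^2c^2-16b^2c-2c^2-4b^2-b^2c^4+4b^3c^4-12b^3c^3+4bc^3+24b^3c-8bc-2b^4c^4+12b^4c^3-26b^4c^2-8b^2c^3+24b^4c-16b^3-8b^4)(bc-1-b)^{-2}(bc-c-2b)^{-2}$; $E_{21}=\frac{b}{2}(5c^6b-2c^6b^2+52c^5b^2-16c^5b-2c^7b^2+2b^4c^8+142b^4c^6-26b^4c^7-426b^4c^5-61b^3c^6+100b^3c^5+14c^7b^3-c^8b^3-20bc^2-8b^2c^2-16b^2c-128b^2c^4-200b^3c^3+244b^3c^2+32bc^3-112b^3c+768b^4c^4-852b^4c^3+568b^4c^2+104b^2c^3-208b^4c+8c^4-4c^3+16b^3+32b^4-2c^5)\,\Delta^{-1}(bc-1-b)^{-2}(bc-c-2b)^{-2}$;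 $E_{12}=(16b^6+32b^5-6c^5b^2+2c^5b-62b^5c^6+62b^6c^6-180b^6c^5+18b^5c^7-12b^6c^7-2b^5c^8+b^6c^8+248b^5c^2+248b^6c^2-96b^6c+321b^6c^4-180b^5c^3-144b^5c-360b^6c^3+b^4c^8+8b^4c^6-6b^4c^7+18b^4c^5+7b^3c^6+90b^5c^5-14b^3c^5-c^7b^3+17b^2c^4+28b^3c^3-28b^3c^2-4bc^3+8b^3c-57b^4c^4+36b^4c^3+32b^4c^2-12b^2c^3-48b^4c-c^4+16b^4)\,\Delta^{-1}(bc-1-b)^{-2}(bc-c-2b)^{-2}$; $E_{03}=\frac{b}{2}(b^2c^4-5b^2c^3+10b^2c^2-10b^2c+4b^2+2bc+2c^2-bc^3)(2b^2c^4-12b^2c^3+26b^2c^2-24b^2c+8b^2-c^4b+3bc^3-6bc+4b+c^3-2c^2+2c)\,\Delta^{-1}(bc-1-b)^{-2}(bc-c-2b)^{-2}$; $E_{30}=c\,b^2(1-c)(c-2)(bc^2-4bc+2+4b)(2bc^2-c^2-4bc+2b)\,\Delta^{-1}(bc-1-b)^{-2}(bc-c-2b)^{-2}$. Define $P(x)=x^3-E_{10}x^2+E_{20}x-E_{30}$ and $Q(d)=d^3-E_{01}d^2+E_{02}d-E_{03}$. For numbers $x_1,x_2,x_3,d_1,d_2,d_3$ the auxiliary equations are: $x_1x_2d_3+x_2x_3d_1+x_3x_1d_2=E_{21}$, $x_1d_2+d_1x_2+x_2d_3+d_2x_3+x_3d_1+d_3x_1=E_{11}$, $x_1d_2d_3+x_2d_3d_1+x_3d_1d_2=E_{12}$.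 Problem 1.2 (equivalent to finding a perfect cuboid) asks for rational $b,c$ such that $P$ and $Q$ have positive rational roots $x_1,x_2,x_3$ and $d_1,d_2,d_3$ satisfying the auxiliary equations. *)

theory Defs
  imports "HOL-Computational_Algebra.Computational_Algebra"
begin

text \<open>
  The coefficients are meaningful only when \<open>cuboid_Delta b c * cuboid_N b c \<noteq> 0\<close>;
  otherwise Isabelle's convention \<open>x / 0 = 0\<close> applies. (Expanding \<open>cuboid_N\<close> yields
  \<open>cuboid_D\<close>, so no separate condition on the latter is needed.) The factor
  \<open>1 / ((bc - 1 - b)^2 (bc - c - 2b)^2)\<close> is written as a division by \<open>(cuboid_N b c)^2\<close>.
\<close>

definition cuboid_Delta :: "rat \<Rightarrow> rat \<Rightarrow> rat" where
  "cuboid_Delta b c =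
     b^2 * c^4 - 6 * b^2 * c^3 + 13 * b^2 * c^2 - 12 * b^2 * c + 4 * b^2 + c^2"

definition cuboid_N :: "rat \<Rightarrow> rat \<Rightarrow> rat" where
  "cuboid_N b c =
     (b * c - 1 - b) * (b * c - c - 2 * b)"

definition cuboid_D :: "rat \<Rightarrow> rat \<Rightarrow> rat" where
  "cuboid_D b c =
     b^2 * c^2 + 2 * b^2 - 3 * b^2 * c + c - b * c^2 + 2 * b"

definition E11 :: "rat \<Rightarrow> rat \<Rightarrow> rat" where
  "E11 b c =
     -(b * (c^2 + 2 - 4 * c)) / cuboid_D b c"

definition E01 :: "rat \<Rightarrow> rat \<Rightarrow> rat" where
  "E01 b c =
     -(b * (c^2 + 2 - 2 * c)) / cuboid_D b c"

definition E10 :: "rat \<Rightarrow> rat \<Rightarrow> rat" where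
  "E10 b c =
     -(b^2 * c^2 + 2 * b^2 - 3 * b^2 * c - c) / cuboid_D b c"

definition E20 :: "rat \<Rightarrow> rat \<Rightarrow> rat" where
  "E20 b c =
     b / 2 * (b * c^2 - 2 * c - 2 * b) * (2 * b * c^2 - c^2 - 6 * b * c + 2 + 4 * b) /
     (cuboid_N b c)^2"

definition E02 :: "rat \<Rightarrow> rat \<Rightarrow> rat" where
  "E02 b c =
     1 / 2 * (28 * b^2 * c^2 - 16 * b^2 * c - 2 * c^2 - 4 * b^2 - b^2 * c^4 + 4 * b^3 *
     c^4 - 12 * b^3 * c^3 + 4 * b * c^3 + 24 * b^3 * c - 8 * b * c - 2 * b^4 * c^4 + 12 *
     b^4 * c^3 - 26 * b^4 * c^2 - 8 * b^2 * c^3 + 24 * b^4 * c - 16 * b^3 - 8 * b^4) /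
     (cuboid_N b c)^2"

definition E21 :: "rat \<Rightarrow> rat \<Rightarrow> rat" where
  "E21 b c =
     b / 2 * (5 * c^6 * b - 2 * c^6 * b^2 + 52 * c^5 * b^2 - 16 * c^5 * b - 2 * c^7 * b^2
     + 2 * b^4 * c^8 + 142 * b^4 * c^6 - 26 * b^4 * c^7 - 426 * b^4 * c^5 - 61 * b^3 * c^6
     + 100 * b^3 * c^5 + 14 * c^7 * b^3 - c^8 * b^3 - 20 * b * c^2 - 8 * b^2 * c^2 - 16 *
     b^2 * c - 128 * b^2 * c^4 - 200 * b^3 * c^3 + 244 * b^3 * c^2 + 32 * b * c^3 - 112 *
     b^3 * c + 768 * b^4 * c^4 - 852 * b^4 * c^3 + 568 * b^4 * c^2 + 104 * b^2 * c^3 - 208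
     * b^4 * c + 8 * c^4 - 4 * c^3 + 16 * b^3 + 32 * b^4 - 2 * c^5) / (cuboid_Delta b c *
     (cuboid_N b c)^2)"

definition E12 :: "rat \<Rightarrow> rat \<Rightarrow> rat" where
  "E12 b c =
     (16 * b^6 + 32 * b^5 - 6 * c^5 * b^2 + 2 * c^5 * b - 62 * b^5 * c^6 + 62 * b^6 * c^6
     - 180 * b^6 * c^5 + 18 * b^5 * c^7 - 12 * b^6 * c^7 - 2 * b^5 * c^8 + b^6 * c^8 + 248
     * b^5 * c^2 + 248 * b^6 * c^2 - 96 * b^6 * c + 321 * b^6 * c^4 - 180 * b^5 * c^3 -
     144 * b^5 * c - 360 * b^6 * c^3 + b^4 * c^8 + 8 * b^4 * c^6 - 6 * b^4 * c^7 + 18 *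
     b^4 * c^5 + 7 * b^3 * c^6 + 90 * b^5 * c^5 - 14 * b^3 * c^5 - c^7 * b^3 + 17 * b^2 *
     c^4 + 28 * b^3 * c^3 - 28 * b^3 * c^2 - 4 * b * c^3 + 8 * b^3 * c - 57 * b^4 * c^4 +
     36 * b^4 * c^3 + 32 * b^4 * c^2 - 12 * b^2 * c^3 - 48 * b^4 * c - c^4 + 16 * b^4) /
     (cuboid_Delta b c * (cuboid_N b c)^2)"

definition E03 :: "rat \<Rightarrow> rat \<Rightarrow> rat" where
  "E03 b c =
     b / 2 * (b^2 * c^4 - 5 * b^2 * c^3 + 10 * b^2 * c^2 - 10 * b^2 * c + 4 * b^2 + 2 * b
     * c + 2 * c^2 - b * c^3) * (2 * b^2 * c^4 - 12 * b^2 * c^3 + 26 * b^2 * c^2 - 24 *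
     b^2 * c + 8 * b^2 - c^4 * b + 3 * b * c^3 - 6 * b * c + 4 * b + c^3 - 2 * c^2 + 2 *
     c) / (cuboid_Delta b c * (cuboid_N b c)^2)"

definition E30 :: "rat \<Rightarrow> rat \<Rightarrow> rat" where
  "E30 b c =
     c * b^2 * (1 - c) * (c - 2) * (b * c^2 - 4 * b * c + 2 + 4 * b) * (2 * b * c^2 - c^2
     - 4 * b * c + 2 * b) / (cuboid_Delta b c * (cuboid_N b c)^2)"

definition cuboid_P :: "rat \<Rightarrow> rat \<Rightarrow> rat poly" where
  "cuboid_P b c = [:- E30 b c, E20 b c, - E10 b c, 1:]"

definition cuboid_Q :: "rat \<Rightarrow> rat \<Rightarrow> rat poly" where
  "cuboid_Q b c = [:- E03 b c, E02 b c, - E01 b c, 1:]"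

text \<open>\<open>r1, r2, r3\<close> list all roots of a monic cubic, each as often as its multiplicity.\<close>

definition cubic_roots :: "rat poly \<Rightarrow> rat \<Rightarrow> rat \<Rightarrow> rat \<Rightarrow> bool" where
  "cubic_roots p r1 r2 r3 \<longleftrightarrow> p = [:- r1, 1:] * [:- r2, 1:] * [:- r3, 1:]"

definition auxiliary_equations ::
    "rat \<Rightarrow> rat \<Rightarrow> rat \<Rightarrow> rat \<Rightarrow> rat \<Rightarrow> rat \<Rightarrow> rat \<Rightarrow> rat \<Rightarrow> bool" where
  "auxiliary_equations b c x1 x2 x3 d1 d2 d3 \<longleftrightarrow>
     x1 * x2 * d3 + x2 * x3 * d1 + x3 * x1 * d2 = E21 b c \<and>
     x1 * d2 + d1 * x2 + x2 * d3 + d2 * x3 + x3 * d1 + d3 * x1 = E11 b c \<and>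
     x1 * d2 * d3 + x2 * d3 * d1 + x3 * d1 * d2 = E12 b c"

text \<open>
  The pair \<open>(b, c)\<close> solves the problem to which the existence of a perfect cuboid is reduced.
\<close>

definition solves_cuboid_problem :: "rat \<Rightarrow> rat \<Rightarrow> bool" where
  "solves_cuboid_problem b c \<longleftrightarrow>
     cuboid_Delta b c * cuboid_N b c \<noteq> 0 \<and>
     (\<exists>x1 x2 x3 d1 d2 d3.
        cubic_roots (cuboid_P b c) x1 x2 x3 \<and> cubic_roots (cuboid_Q b c) d1 d2 d3 \<and>
        auxiliary_equations b c x1 x2 x3 d1 d2 d3 \<and>
        x1 > 0 \<and> x2 > 0 \<and> x3 > 0 \<and> d1 > 0 \<and> d2 > 0 \<and> d3 > 0)"

end

theory Submission
  imports Defs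
begin

text \<open>
  At \<open>c = 2\<close> one has \<open>\<Delta> = 4\<close>, \<open>N = 2 (1 - b)\<close> and \<open>E\<^sub>3\<^sub>0 = 0\<close>, so \<open>0\<close> is a root of \<open>P\<close>, which rules
  out positivity, while \<open>1\<close> is a root of \<open>Q\<close>. Both remaining quadratic factors have discriminant
  \<open>(2 b\<^sup>2 - 4 b + 1) / (b - 1)\<^sup>2\<close>, and \<open>2 b\<^sup>2 - 4 b + 1\<close> is the square of
  \<open>(t\<^sup>2 - 2) / (t\<^sup>2 + 4 t + 2)\<close> when \<open>b = 2 t / (t\<^sup>2 + 4 t + 2)\<close>.
\<close>

lemma cuboid_Delta_2: "cuboid_Delta b 2 = 4"
  by (simp add: cuboid_Delta_def)

lemma cuboid_N_2: "cuboid_N b 2 = 2 * (1 - b)"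
  by (simp add: cuboid_N_def algebra_simps)

lemma cuboid_D_2: "cuboid_D b 2 = 2 * (1 - b)"
  by (simp add: cuboid_D_def algebra_simps)

lemma E30_2: "E30 b 2 = 0"
  by (simp add: E30_def)

lemma poly_cuboid_P_2: "poly (cuboid_P b 2) 0 = 0"
  by (simp add: cuboid_P_def E30_2)

text \<open>Comparing constant terms gives \<open>x1 * x2 * x3 = 0\<close> for every labelling of
  the roots.\<close>

lemma not_solves_cuboid_problem_2: "\<not> solves_cuboid_problem b 2"
  by (auto simp: solves_cuboid_problem_def cubic_roots_def cuboid_P_def E30_2)

context
  fixes b :: rat
  assumes b: "b \<noteq> 1"
begin

lemma E11_2: "E11 b 2 = - b / (b - 1)"
  using b by (simp add: E11_def cuboid_D_2 divide_simps) (simp add: algebra_simps)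

lemma E01_2: "E01 b 2 = b / (b - 1)"
  using b by (simp add: E01_def cuboid_D_2 divide_simps) (simp add: algebra_simps)

lemma E10_2: "E10 b 2 = - 1 / (b - 1)"
  using b by (simp add: E10_def cuboid_D_2 divide_simps)

lemma E20_2: "E20 b 2 = b * (2 - b) / (2 * (b - 1)^2)"
  using b by (simp add: E20_def cuboid_N_2 divide_simps) algebra

lemma E02_2: "E02 b 2 = (4 * b - b^2 - 2) / (2 * (b - 1)^2)"
  using b by (simp add: E02_def cuboid_N_2 divide_simps) algebra

lemma E21_2: "E21 b 2 = b * (2 - b) / (2 * (b - 1)^2)"
  using b by (simp add: E21_def cuboid_N_2 cuboid_Delta_2 divide_simps) algebra

lemma E12_2: "E12 b 2 = - 1"
  using b by (simp add: E12_def cuboid_N_2 cuboid_Delta_2 divide_simps) algebra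

lemma E03_2: "E03 b 2 = b * (2 - b) / (2 * (b - 1)^2)"
  using b by (simp add: E03_def cuboid_N_2 cuboid_Delta_2 divide_simps) algebra

lemma poly_cuboid_Q_2: "poly (cuboid_Q b 2) 1 = 0"
  using b
  by (simp add: cuboid_Q_def E01_2 E02_2 E03_2 divide_simps) algebra

text \<open>The quadratic factor of \<open>P\<close> has roots \<open>x2\<close>, \<open>x3\<close>,
  and that of \<open>Q\<close> is its reflection under negation. The negated roots are listed
  crosswise so that \<open>x2 * d3\<close> and \<open>x3 * d2\<close> become \<open>- x2^2\<close>
  and \<open>- x3^2\<close>.\<close>

lemma roots_cuboid_2:
  assumes u: "u^2 = 2 * b^2 - 4 * b + 1"
  defines "x2 \<equiv> (u - 1) / (2 * (b - 1))" and "x3 \<equiv> - (u + 1) / (2 * (b - 1))"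
  shows "cubic_roots (cuboid_P b 2) 0 x2 x3"
    and "cubic_roots (cuboid_Q b 2) 1 (- x3) (- x2)"
    and "auxiliary_equations b 2 0 x2 x3 1 (- x3) (- x2)"
proof -
  have sum: "x2 + x3 = - 1 / (b - 1)"
    using b by (simp add: x2_def x3_def divide_simps)
  have "x2 * x3 = (1 - u^2) / (4 * (b - 1)^2)"
    using b by (simp add: x2_def x3_def divide_simps) algebra
  also have "\<dots> = b * (2 - b) / (2 * (b - 1)^2)"
    using b by (simp add: u divide_simps) algebra
  finally have prod: "x2 * x3 = b * (2 - b) / (2 * (b - 1)^2)" .
  have E01: "E01 b 2 = 1 - (x2 + x3)" and E11: "E11 b 2 = x2 + x3 - 1"
    using b by (simp_all add: E01_2 E11_2 sum field_simps)
  have E02: "E02 b 2 = x2 * x3 - (x2 + x3)"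
    using b by (simp add: E02_2 sum prod divide_simps) algebra
  \<comment> \<open>With the crosswise labelling, this sum of squares is what the equations for
    \<open>E11\<close> and \<open>E12\<close> reduce to.\<close>
  have "x2^2 + x3^2 = (x2 + x3)^2 - 2 * (x2 * x3)"
    by algebra
  also have "\<dots> = 1"
    unfolding sum prod using b by (simp add: divide_simps) algebra
  finally have squares: "x2^2 + x3^2 = 1" .
  show "cubic_roots (cuboid_P b 2) 0 x2 x3"
    using sum prod by (simp add: mult.commute[of x3] cubic_roots_def cuboid_P_def E30_2 E20_2 E10_2)
  show "cubic_roots (cuboid_Q b 2) 1 (- x3) (- x2)"
    using prod by (simp add: cubic_roots_def cuboid_Q_def E03_2 E02 E01 algebra_simps)
  show "auxiliary_equations b 2 0 x2 x3 1 (- x3) (- x2)"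
    using squares prod
    by (simp add: auxiliary_equations_def E21_2 E11 E12_2 power2_eq_square algebra_simps)
qed

end

text \<open>A root splits off a linear factor whose cofactor has degree 2, so neither factor is a
  unit.\<close>

lemma cubic_root_not_irreducible:
  fixes p :: "'a :: field poly"
  assumes "poly p r = 0" and "degree p = 3"
  shows "\<not> irreducible p"
proof
  assume "irreducible p"
  obtain q where q: "p = [:- r, 1:] * q"
    using assms(1) by (auto simp: poly_eq_0_iff_dvd)
  have "p \<noteq> 0"
    using assms(2) by auto
  then have "q \<noteq> 0"
    using q by auto
  then have "degree q = 2"
    using assms(2) unfolding q by (subst (asm) degree_mult_eq) auto
  moreover have "[:- r, 1:] dvd 1 \<or> q dvd 1"
    using \<open>irreducible p\<close> q by (rule irreducibleD)
  ultimately show False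
    using \<open>q \<noteq> 0\<close> by (auto simp: is_unit_iff_degree)
qed

text \<open>
  The denominator has no rational zero, but excluding one is unnecessary: division by zero would
  give \<open>b = 0\<close>, for which \<open>u = 1\<close> works.
\<close>

lemma discriminant_is_square:
  fixes b t :: rat
  assumes "b = 2 * t / ((t + 2)^2 - 2)"
  obtains u where "u^2 = 2 * b^2 - 4 * b + 1"
proof (cases "(t + 2)^2 - 2 = 0")
  case True
  then show ?thesis
    using assms that[of 1] by simp
next
  case False
  define s where "s = (t + 2)^2 - 2"
  have "s \<noteq> 0" and bs: "b = 2 * t / s"
    using False assms by (simp_all add: s_def)
  \<comment> \<open>The line \<open>u = (t + 2) * b - 1\<close> through the point
    \<open>b = 0\<close>, \<open>u = -1\<close> of the conic
    \<open>u^2 = 2 * b^2 - 4 * b + 1\<close> meets it again at the given \<open>b\<close>, with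
    \<open>u = (t^2 - 2) / s\<close>. Here denominators are cleared.\<close>
  have "(t^2 - 2)^2 = 2 * (2 * t)^2 - 4 * (2 * t) * s + s^2"
    unfolding s_def by algebra
  then have "((t^2 - 2) / s)^2 = 2 * b^2 - 4 * b + 1"
    using \<open>s \<noteq> 0\<close> by (simp add: bs power_divide field_simps power2_eq_square)
  then show ?thesis
    by (rule that)
qed

theorem theorem5p1:
  fixes b c :: rat
  assumes "b \<noteq> 1" and "c = 2"
  shows "\<not> irreducible (cuboid_P b c) \<and> \<not> irreducible (cuboid_Q b c) \<and>
    (\<forall>t::rat. b = 2 * t / ((t + 2)^2 - 2) \<longrightarrow>
      (\<exists>x1 x2 x3 d1 d2 d3.
         cubic_roots (cuboid_P b c) x1 x2 x3 \<and> cubic_roots (cuboid_Q b c) d1 d2 d3 \<and>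
         auxiliary_equations b c x1 x2 x3 d1 d2 d3 \<and>
         \<not> (x1 > 0 \<and> x2 > 0 \<and> x3 > 0 \<and> d1 > 0 \<and> d2 > 0 \<and> d3 > 0)) \<and>
      \<not> solves_cuboid_problem b c)"
proof (intro conjI allI impI)
  show "\<not> irreducible (cuboid_P b c)"
    using cubic_root_not_irreducible[OF poly_cuboid_P_2] assms(2)
    by (simp add: cuboid_P_def)
  show "\<not> irreducible (cuboid_Q b c)"
    using cubic_root_not_irreducible[OF poly_cuboid_Q_2[OF assms(1)]] assms(2)
    by (simp add: cuboid_Q_def)
next
  fix t :: rat
  assume "b = 2 * t / ((t + 2)^2 - 2)"
  then obtain u where "u^2 = 2 * b^2 - 4 * b + 1"
    by (rule discriminant_is_square)
  from roots_cuboid_2[OF assms(1) this]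
  show "\<exists>x1 x2 x3 d1 d2 d3.
      cubic_roots (cuboid_P b c) x1 x2 x3 \<and> cubic_roots (cuboid_Q b c) d1 d2 d3 \<and>
      auxiliary_equations b c x1 x2 x3 d1 d2 d3 \<and>
      \<not> (x1 > 0 \<and> x2 > 0 \<and> x3 > 0 \<and> d1 > 0 \<and> d2 > 0 \<and> d3 > 0)"
    \<comment> \<open>The witness for \<open>x1\<close> is 0, so positivity fails there.\<close>
    unfolding assms(2) by (metis less_irrefl)
next
  show "\<not> solves_cuboid_problem b c"
    using not_solves_cuboid_problem_2 assms(2) by simp
qed

end
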